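(* Let $d\geq1$, $\mathcal X=\{-1,1\}^d$, and let $p:\mathcal X\to(0,1)$ be a strictly positive probability distribution with Glauber score $\delta\log p$. Let $$\beta_2=\max_{x\neq y\in\mathcal X}\frac{\|\delta\log p(x)-\delta\log p(y)\|_\infty}{\|x-y\|_1}.$$ Let $\eta>0$ and let $t_{\rm DULA}$ be the DULA kernel with step-size parameter $\eta$ and with $s$ equal to the Gibbs score, $s(x)_i=x_i\log\big(1+\exp(2x_i\,\delta\log p(x)_i)\big)$. Assume $4d\beta_2\leq1$ and $d\,e^{-2/\eta}\leq1$. Then the invariant probability measure $\hat p_{\rm DULA}$ of $t_{\rm DULA}$ satisfies $$\mathcal W(\hat p_{\rm DULA},p)\leq\frac{4d}{1+e^{2/\eta}}.$$
   Context: For $x\in\mathcal X$ and $u\in\{-1,1\}$, $(u,x_{-i})$ denotes the vector obtained from $x$ by setting its $i$-th coordinate to $u$ and keeping the other coordinates. The Glauber score $\delta\log p:\mathcal X\to\mathbb R^d$ is $[\delta\log p(x)]_i=\frac12\log p(1,x_{-i})-\frac12\log p(-1,x_{-i})$. For $\eta>0$ and a score function $s:\mathcal X\to\mathbb R^d$, the DULA (discrete unadjusted Langevin algorithm) kernel on $\mathcal X$ is $t_{\rm DULA}(x'|x)\propto\exp\big((x/\eta+s(x)/2)^\top x'\big)$, normalized over $x'\in\mathcal X$; all its entries are positive, so it has a unique invariant probability measure. The Hamming loss is $\ell(x,y)=\sum_{i=1}^d\mathbf 1\{x_i\neq y_i\}$, and the Wasserstein distance between probability distributions $q,r$ on $\mathcal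 X$ is $\mathcal W(q,r)=\min\mathbb E[\ell(X,Y)]$, the minimum being over all couplings $(X,Y)$ with $X\sim q$, $Y\sim r$. *)

theory Defs
  imports "HOL-Probability.Probability"
begin

definition hypercube :: "(real ^ 'n) set" where
  "hypercube = {x. \<forall>i. x $ i \<in> {-1, 1}}"

definition set_coord :: "real \<Rightarrow> real ^ 'n \<Rightarrow> 'n \<Rightarrow> real ^ 'n" where
  "set_coord u x i = (\<chi> j. if j = i then u else x $ j)"

definition glauber_score :: "(real ^ 'n) pmf \<Rightarrow> real ^ 'n \<Rightarrow> real ^ 'n" where
  "glauber_score p x =
     (\<chi> i. 1/2 * ln (pmf p (set_coord 1 x i)) - 1/2 * ln (pmf p (set_coord (-1) x i)))"

definition gibbs_score :: "(real ^ 'n) pmf \<Rightarrow> real ^ 'n \<Rightarrow> real ^ 'n" where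
  "gibbs_score p x = (\<chi> i. x $ i * ln (1 + exp (2 * x $ i * glauber_score p x $ i)))"

definition l1norm :: "real ^ 'n \<Rightarrow> real" where
  "l1norm x = (\<Sum>i\<in>UNIV. \<bar>x $ i\<bar>)"

definition beta2 :: "(real ^ 'n) pmf \<Rightarrow> real" where
  "beta2 p = Max {infnorm (glauber_score p x - glauber_score p y) / l1norm (x - y) | x y.
                    x \<in> hypercube \<and> y \<in> hypercube \<and> x \<noteq> y}"

text \<open>
  The first point is the current state, the second the next one:
  \<open>dula_kernel \<eta> s x y\<close> is the transition probability $t(y \mid x)$.
\<close>
definition dula_kernel ::
  "real \<Rightarrow> (real ^ 'n \<Rightarrow> real ^ 'n) \<Rightarrow> real ^ 'n \<Rightarrow> real ^ 'n \<Rightarrow> real" where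
  "dula_kernel \<eta> s x y =
     exp ((x /\<^sub>R \<eta> + s x /\<^sub>R 2) \<bullet> y) / (\<Sum>z\<in>hypercube. exp ((x /\<^sub>R \<eta> + s x /\<^sub>R 2) \<bullet> z))"

definition invariant_distribution ::
  "(real ^ 'n \<Rightarrow> real ^ 'n \<Rightarrow> real) \<Rightarrow> (real ^ 'n) pmf \<Rightarrow> bool" where
  "invariant_distribution t q \<longleftrightarrow>
     set_pmf q \<subseteq> hypercube \<and>
     (\<forall>y\<in>hypercube. (\<Sum>x\<in>hypercube. pmf q x * t x y) = pmf q y)"

definition hamming :: "real ^ 'n \<Rightarrow> real ^ 'n \<Rightarrow> real" where
  "hamming x y = (\<Sum>i\<in>UNIV. of_bool (x $ i \<noteq> y $ i))"

definition couplings :: "'a pmf \<Rightarrow> 'b pmf \<Rightarrow> ('a \<times> 'b) pmf set" where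
  "couplings q r = {\<pi>. map_pmf fst \<pi> = q \<and> map_pmf snd \<pi> = r}"

text \<open>
  The couplings of two distributions on the hypercube form a nonempty compact set on which
  the expected loss is continuous, so the infimum below is a minimum.
\<close>
definition wasserstein :: "(real ^ 'n) pmf \<Rightarrow> (real ^ 'n) pmf \<Rightarrow> real" where
  "wasserstein q r =
     (INF \<pi>\<in>couplings q r. measure_pmf.expectation \<pi> (\<lambda>(x, y). hamming x y))"

end

(* Let E = exp (2/eta) and a = 1/(1+E). With the Gibbs score, DULA flips the spins of x
   independently, spin i with probability g/(g+E), where g is the probability that a heat-bath
   update of spin i flips it. This is within a^2/2 of a*g, the flip probability of a lazy
   heat-bath update (resample with probability a). A sweep of lazy heat-bath updates through all
   coordinates leaves p invariant.
   Couple the DULA step from x with the sweep from z, coordinate by coordinate, by optimal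
   couplings of the spins. As g changes by at most ham(x,z)/(4d) between x and z, and the sweep
   has flipped at most a*d spins on average, the expected Hamming distance afterwards is at most
   (1 - 3a/4) ham(x,z) + (3/4) d a^2. Starting from an arbitrary coupling of the two invariant
   laws, this gives W <= (1 - 3a/4) W + (3/4) d a^2, hence W <= d a. *)
theory Submission imports Defs begin

section \<open>Finiteness of the cube, coordinate updates, expectations of mixtures\<close>

lemma finite_hypercube: "finite (hypercube :: (real ^ 'n) set)"
proof -
  have "hypercube \<subseteq> (\<lambda>f. \<chi> i. f i) ` (Pi\<^sub>E UNIV (\<lambda>i::'n. {-1, 1::real}))"
  proof
    fix x :: "real ^ 'n" assume "x \<in> hypercube"
    then have "($) x \<in> Pi\<^sub>E UNIV (\<lambda>i::'n. {-1, 1::real})"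
      by (auto simp: hypercube_def PiE_def)
    moreover have "x = (\<chi> i. x $ i)" by simp
    ultimately show "x \<in> (\<lambda>f. \<chi> i. f i) ` (Pi\<^sub>E UNIV (\<lambda>i::'n. {-1, 1::real}))" by blast
  qed
  then show ?thesis by (rule finite_subset) (auto intro!: finite_imageI finite_PiE)
qed

lemma set_coord_nth: "set_coord u x i $ j = (if j = i then u else x $ j)"
  by (simp add: set_coord_def)

lemma set_coord_hypercube: "x \<in> hypercube \<Longrightarrow> u \<in> {-1, 1} \<Longrightarrow> set_coord u x i \<in> hypercube"
  by (auto simp: hypercube_def set_coord_nth)

lemma hypercube_nth: "x \<in> hypercube \<Longrightarrow> x $ i = -1 \<or> x $ i = 1"
  by (auto simp: hypercube_def)

lemma expectation_bind_le:
  fixes h :: "'b \<Rightarrow> real"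
  assumes "finite (set_pmf M)" "\<And>x. x \<in> set_pmf M \<Longrightarrow> finite (set_pmf (f x))"
    and "\<And>x. x \<in> set_pmf M \<Longrightarrow> measure_pmf.expectation (f x) h \<le> k x"
  shows "measure_pmf.expectation (M \<bind> f) h \<le> measure_pmf.expectation M k"
proof -
  have "measure_pmf.expectation (M \<bind> f) h
      = (\<Sum>x\<in>set_pmf M. pmf M x *\<^sub>R measure_pmf.expectation (f x) h)"
    using assms by (intro pmf_expectation_bind) auto
  also have "\<dots> \<le> (\<Sum>x\<in>set_pmf M. pmf M x *\<^sub>R k x)"
    using assms by (intro sum_mono) (auto intro: mult_left_mono)
  also have "\<dots> = measure_pmf.expectation M k"
    using assms by (subst integral_measure_pmf[where A="set_pmf M"]) (auto simp: set_pmf_eq)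
  finally show ?thesis .
qed

section \<open>Optimal couplings of two Bernoulli laws\<close>

text \<open>Monotone coupling: the bit with the larger parameter is drawn first, and the other one
  is a thinning of it. A zero denominator occurs only for \<open>s = t = 0\<close>, where
  \<open>0 / 0 = 0\<close> is a valid thinning probability.\<close>

definition bernoulli_coupling :: "real \<Rightarrow> real \<Rightarrow> (bool \<times> bool) pmf" where
  "bernoulli_coupling s t =
     (if s \<le> t then bernoulli_pmf t \<bind> (\<lambda>C. map_pmf (\<lambda>B. (B \<and> C, C)) (bernoulli_pmf (s / t)))
      else bernoulli_pmf s \<bind> (\<lambda>B. map_pmf (\<lambda>C. (B, C \<and> B)) (bernoulli_pmf (t / s))))"

lemma bernoulli_thinning:
  assumes "0 \<le> s" "s \<le> t" "t \<le> 1"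
  shows "bernoulli_pmf t \<bind> (\<lambda>C. map_pmf (\<lambda>B. B \<and> C) (bernoulli_pmf (s / t))) = bernoulli_pmf s"
proof (rule pmf_eqI)
  fix b
  have st: "0 \<le> s / t" "s / t \<le> 1" using assms by (auto simp: divide_le_eq_1)
  have t: "pmf (bernoulli_pmf t \<bind> (\<lambda>C. map_pmf (\<lambda>B. B \<and> C) (bernoulli_pmf (s / t)))) True = s"
    using assms st by (simp add: pmf_bind)
  have f: "pmf (bernoulli_pmf t \<bind> (\<lambda>C. map_pmf (\<lambda>B. B \<and> C) (bernoulli_pmf (s / t)))) False = 1 - s"
    using assms st by (auto simp: pmf_bind algebra_simps)
  show "pmf (bernoulli_pmf t \<bind> (\<lambda>C. map_pmf (\<lambda>B. B \<and> C) (bernoulli_pmf (s / t)))) b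
      = pmf (bernoulli_pmf s) b"
    using t f assms by (cases b) auto
qed

lemma bernoulli_coupling_marginals:
  assumes "s \<in> {0..1}" "t \<in> {0..1}"
  shows "map_pmf fst (bernoulli_coupling s t) = bernoulli_pmf s"
    and "map_pmf snd (bernoulli_coupling s t) = bernoulli_pmf t"
  using assms bernoulli_thinning[of s t] bernoulli_thinning[of t s]
  by (auto simp: bernoulli_coupling_def map_bind_pmf pmf.map_comp o_def bind_return_pmf')

lemma expectation_bind_bernoulli:
  fixes h :: "'b \<Rightarrow> real"
  assumes "\<beta> \<in> {0..1}" "\<And>b. finite (set_pmf (f b))"
  shows "measure_pmf.expectation (bernoulli_pmf \<beta> \<bind> f) h =
    \<beta> * measure_pmf.expectation (f True) h + (1 - \<beta>) * measure_pmf.expectation (f False) h"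
  using assms by (subst pmf_expectation_bind[where A=UNIV]) (auto simp: UNIV_bool)

text \<open>The bits differ exactly when the larger one is true and the thinning rejects it, which
  for \<open>s \<le> t\<close> and \<open>t > 0\<close> has probability
  \<open>t * (1 - s / t)\<close>. This is the total variation distance, so no coupling does
  better.\<close>

lemma bernoulli_coupling_neq:
  assumes "s \<in> {0..1}" "t \<in> {0..1}"
  shows "measure_pmf.expectation (bernoulli_coupling s t) (\<lambda>(B, C). of_bool (B \<noteq> C)) = \<bar>s - t\<bar>"
proof -
  have *: "0 \<le> s / t" "s / t \<le> 1" if "s \<le> t" using assms that by (auto simp: divide_le_eq_1)
  have **: "0 \<le> t / s" "t / s \<le> 1" if "t \<le> s" using assms that by (auto simp: divide_le_eq_1)
  show ?thesis
  proof (cases "s \<le> t")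
    case True
    then show ?thesis using assms *
      by (simp add: bernoulli_coupling_def expectation_bind_bernoulli right_diff_distrib)
  next
    case False
    then show ?thesis using assms **
      by (simp add: bernoulli_coupling_def expectation_bind_bernoulli right_diff_distrib)
  qed
qed

section \<open>Sweeps through the coordinates and their couplings\<close>

definition spin :: "bool \<Rightarrow> real" where
  "spin b = (if b then 1 else - 1)"

text \<open>\<open>r z i\<close> is the probability that spin \<open>i\<close> becomes 1, evaluated
  at the state reached so far. State-independent rates give independent spins, as in a DULA step;
  state-dependent rates give a systematic scan. Both chains thus become instances of one
  construction.\<close>

primrec sweep :: "(real ^ 'n \<Rightarrow> 'n \<Rightarrow> real) \<Rightarrow> 'n list \<Rightarrow> real ^ 'n \<Rightarrow> (real ^ 'n) pmf" where
  "sweep r [] z = return_pmf z"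
| "sweep r (i # is) z = bernoulli_pmf (r z i) \<bind> (\<lambda>B. sweep r is (set_coord (spin B) z i))"

primrec sweep_coupling :: "(real ^ 'n \<Rightarrow> 'n \<Rightarrow> real) \<Rightarrow> (real ^ 'n \<Rightarrow> 'n \<Rightarrow> real) \<Rightarrow> 'n list
    \<Rightarrow> real ^ 'n \<Rightarrow> real ^ 'n \<Rightarrow> ((real ^ 'n) \<times> (real ^ 'n)) pmf" where
  "sweep_coupling r r' [] y z = return_pmf (y, z)"
| "sweep_coupling r r' (i # is) y z = bernoulli_coupling (r y i) (r' z i) \<bind>
     (\<lambda>(B, C). sweep_coupling r r' is (set_coord (spin B) y i) (set_coord (spin C) z i))"

lemma spin_in: "spin b \<in> {-1, 1}"
  by (simp add: spin_def)

lemma set_pmf_sweep_hypercube: "z \<in> hypercube \<Longrightarrow> set_pmf (sweep r is z) \<subseteq> hypercube"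
proof (induction "is" arbitrary: z)
  case (Cons i "is")
  from Cons.IH[OF set_coord_hypercube[OF Cons.prems spin_in]] show ?case
    unfolding sweep.simps set_bind_pmf by blast
qed simp

lemma set_pmf_sweep_unchanged: "y \<in> set_pmf (sweep r is z) \<Longrightarrow> j \<notin> set is \<Longrightarrow> y $ j = z $ j"
proof (induction "is" arbitrary: z)
  case (Cons i "is")
  then obtain B where "y \<in> set_pmf (sweep r is (set_coord (spin B) z i))"
    unfolding sweep.simps set_bind_pmf by blast
  then show ?case using Cons.IH Cons.prems(2) by (simp add: set_coord_nth)
qed simp

lemma finite_set_pmf_sweep_coupling: "finite (set_pmf (sweep_coupling r r' is y z))"
proof (induction "is" arbitrary: y z)
  case (Cons i "is")
  then show ?case by (auto simp: case_prod_beta)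
qed simp

text \<open>Each spin pair has the right Bernoulli marginals, and the rate of either chain depends
  on its own state only, so each component evolves as a sweep by itself.\<close>

lemma sweep_coupling_marginals:
  assumes "\<And>y i. r y i \<in> {0..1}" "\<And>z i. r' z i \<in> {0..1}"
  shows "map_pmf fst (sweep_coupling r r' is y z) = sweep r is y"
    and "map_pmf snd (sweep_coupling r r' is y z) = sweep r' is z"
proof (induction "is" arbitrary: y z)
  case (Cons i "is")
  note m = bernoulli_coupling_marginals[OF assms]
  {
    case 1
    have "map_pmf fst (sweep_coupling r r' (i # is) y z)
       = bernoulli_coupling (r y i) (r' z i) \<bind> (\<lambda>BC. sweep r is (set_coord (spin (fst BC)) y i))"
      by (simp add: map_bind_pmf case_prod_beta Cons)
    also have "\<dots> = map_pmf fst (bernoulli_coupling (r y i) (r' z i)) \<bind>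
        (\<lambda>B. sweep r is (set_coord (spin B) y i))"
      by (simp add: bind_map_pmf)
    finally show ?case by (simp only: m sweep.simps)
  next
    case 2
    have "map_pmf snd (sweep_coupling r r' (i # is) y z)
       = bernoulli_coupling (r y i) (r' z i) \<bind> (\<lambda>BC. sweep r' is (set_coord (spin (snd BC)) z i))"
      by (simp add: map_bind_pmf case_prod_beta Cons)
    also have "\<dots> = map_pmf snd (bernoulli_coupling (r y i) (r' z i)) \<bind>
        (\<lambda>B. sweep r' is (set_coord (spin B) z i))"
      by (simp add: bind_map_pmf)
    finally show ?case by (simp only: m sweep.simps)
  }
qed simp_all

lemma pmf_bind_bernoulli:
  "\<beta> \<in> {0..1} \<Longrightarrow> pmf (bernoulli_pmf \<beta> \<bind> f) y = \<beta> * pmf (f True) y + (1 - \<beta>) * pmf (f False) y"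
  by (simp add: pmf_bind)

text \<open>Every listed coordinate is written once, with a rate that ignores the state, so the
  result is a product law.\<close>

lemma pmf_sweep_const:
  assumes "\<And>i. \<alpha> i \<in> {0..1}" and "distinct is" and "y \<in> hypercube"
    and "\<And>j. j \<notin> set is \<Longrightarrow> y $ j = z $ j"
  shows "pmf (sweep (\<lambda>_. \<alpha>) is z) y = (\<Prod>j\<in>set is. if y $ j = 1 then \<alpha> j else 1 - \<alpha> j)"
  using assms(2,4)
proof (induction "is" arbitrary: z)
  case Nil
  then have "y = z" by (simp add: vec_eq_iff)
  then show ?case by simp
next
  case (Cons i "is")
  \<comment> \<open>Coordinate \<open>i\<close> is not visited again, so the branch with spin
    \<open>b\<close> reaches \<open>y\<close> only if \<open>y\<close> carries \<open>b\<close>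
    there.\<close>
  have eq: "pmf (sweep (\<lambda>_. \<alpha>) is (set_coord (spin b) z i)) y =
      (if y $ i = spin b then (\<Prod>j\<in>set is. if y $ j = 1 then \<alpha> j else 1 - \<alpha> j) else 0)" for b
  proof (cases "y $ i = spin b")
    case True
    then show ?thesis using Cons by (auto simp: set_coord_nth)
  next
    case False
    then have "y \<notin> set_pmf (sweep (\<lambda>_. \<alpha>) is (set_coord (spin b) z i))"
      using set_pmf_sweep_unchanged[of y _ "is" "set_coord (spin b) z i" i] Cons.prems
      by (auto simp: set_coord_nth)
    then show ?thesis using False by (simp add: set_pmf_eq)
  qed
  have "y $ i = -1 \<or> y $ i = 1" using assms(3) by (rule hypercube_nth)
  then show ?case using Cons.prems(1) eq[of True] eq[of False]
    by (auto simp: pmf_bind_bernoulli[OF assms(1)] spin_def)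
qed

section \<open>Growth of the Hamming distance along a coupled sweep\<close>

lemma hamming_nonneg: "0 \<le> hamming x y"
  by (simp add: hamming_def sum_nonneg)

lemma hamming_set_coord_le: "hamming x (set_coord u z i) \<le> hamming x z + of_bool (u \<noteq> z $ i)"
proof -
  have "hamming x (set_coord u z i) \<le>
      (\<Sum>j\<in>UNIV. of_bool (x $ j \<noteq> z $ j) + (if j = i then of_bool (u \<noteq> z $ i) else 0))"
    unfolding hamming_def by (rule sum_mono) (auto simp: set_coord_nth)
  also have "\<dots> = hamming x z + of_bool (u \<noteq> z $ i)"
    by (simp add: sum.distrib hamming_def)
  finally show ?thesis .
qed

lemma expectation_bernoulli_coupling_snd:
  fixes f :: "bool \<Rightarrow> real"
  assumes "s \<in> {0..1}" "t \<in> {0..1}"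
  shows "measure_pmf.expectation (bernoulli_coupling s t) (\<lambda>BC. f (snd BC)) = t * f True + (1 - t) * f False"
proof -
  have "measure_pmf.expectation (bernoulli_coupling s t) (\<lambda>BC. f (snd BC)) =
     measure_pmf.expectation (map_pmf snd (bernoulli_coupling s t)) f" by simp
  then show ?thesis using assms
    unfolding bernoulli_coupling_marginals(2)[OF assms] by simp
qed

text \<open>The first chain is refreshed independently with the probabilities \<open>\<alpha>\<close>, which refer to a
  frozen state \<open>x\<close>; the second one moves while the sweep runs, which costs the extra
  \<open>a * length is\<close>.\<close>
lemma expectation_hamming_sweep_coupling:
  fixes x :: "real ^ 'n"
  assumes \<alpha>: "\<And>i. \<alpha> i \<in> {0..1}" and b: "\<And>z i. b z i \<in> {0..1}"
    and diff: "\<And>z i. z \<in> hypercube \<Longrightarrow>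
       \<bar>\<alpha> i - b z i\<bar> \<le> \<rho> * of_bool (x $ i \<noteq> z $ i) + h * hamming x z + k"
    and move: "\<And>z i. z \<in> hypercube \<Longrightarrow> (if z $ i = 1 then 1 - b z i else b z i) \<le> a"
    and "0 \<le> h" "0 \<le> a"
    and "distinct is" "z \<in> hypercube"
  shows "measure_pmf.expectation (sweep_coupling (\<lambda>_. \<alpha>) b is y z) (\<lambda>(y, z). hamming y z) \<le>
    (\<Sum>j\<in>-set is. of_bool (y $ j \<noteq> z $ j)) + \<rho> * (\<Sum>j\<in>set is. of_bool (x $ j \<noteq> z $ j)) +
    real (length is) * (h * (hamming x z + a * real (length is)) + k)"
  \<comment> \<open>The induction varies \<open>y\<close> and \<open>z\<close> but keeps
    \<open>x\<close>, to which \<alpha> refers. Coordinates outside \<open>is\<close> are final and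
    are compared with \<open>y\<close>; pending ones are compared with \<open>x\<close>, because the
    current spin of \<open>y\<close> there will be overwritten.\<close>
  using assms(7,8)
proof (induction "is" arbitrary: y z)
  case Nil
  then show ?case by (simp add: hamming_def)
next
  case (Cons i "is")
  define n where "n = real (length is)"
  define S where "S = (\<Sum>j\<in>-set (i # is). of_bool (y $ j \<noteq> z $ j) :: real)"
  define R where "R = (\<Sum>j\<in>set is. of_bool (x $ j \<noteq> z $ j) :: real)"
  define M where "M = bernoulli_coupling (\<alpha> i) (b z i)"
  \<comment> \<open>\<open>u\<close> records that the new spins disagree, \<open>v\<close> that the
    second chain really moves at \<open>i\<close>.\<close>
  define u :: "bool \<times> bool \<Rightarrow> real" where "u = (\<lambda>BC. of_bool (fst BC \<noteq> snd BC))"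
  define v :: "bool \<times> bool \<Rightarrow> real" where "v = (\<lambda>BC. of_bool (spin (snd BC) \<noteq> z $ i))"
  have fin: "integrable (measure_pmf M) f" for f :: "bool \<times> bool \<Rightarrow> real"
    by (rule integrable_measure_pmf_finite) simp
  have i: "i \<notin> set is" "distinct is" using Cons.prems by auto
  have n0: "n \<ge> 0" by (simp add: n_def)
  \<comment> \<open>Induction hypothesis after one update: \<open>i\<close> joins the final
    coordinates and contributes \<open>u\<close>, pending coordinates are untouched, and the
    distance from \<open>x\<close> to the second chain grows by at most \<open>v\<close>, which each
    of the \<open>n\<close> later updates pays with weight \<open>h\<close>.\<close>
  have step: "measure_pmf.expectation (sweep_coupling (\<lambda>_. \<alpha>) b is (set_coord (spin (fst BC)) y i)
        (set_coord (spin (snd BC)) z i)) (\<lambda>(y, z). hamming y z)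
      \<le> S + \<rho> * R + n * (h * (hamming x z + a * n) + k) + u BC + n * h * v BC" for BC
  proof -
    let ?y = "set_coord (spin (fst BC)) y i" and ?z = "set_coord (spin (snd BC)) z i"
    have ins: "- set is = insert i (- set (i # is))" using i by auto
    have "(\<Sum>j\<in>-set is. of_bool (?y $ j \<noteq> ?z $ j)) =
        of_bool (?y $ i \<noteq> ?z $ i) + (\<Sum>j\<in>-set (i # is). of_bool (?y $ j \<noteq> ?z $ j) :: real)"
      unfolding ins by (rule sum.insert) auto
    also have "(\<Sum>j\<in>-set (i # is). of_bool (?y $ j \<noteq> ?z $ j) :: real) = S"
      unfolding S_def by (rule sum.cong) (auto simp: set_coord_nth)
    also have "of_bool (?y $ i \<noteq> ?z $ i) = u BC" by (simp add: u_def set_coord_nth spin_def)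
    finally have 1: "(\<Sum>j\<in>-set is. of_bool (?y $ j \<noteq> ?z $ j)) = u BC + S" .
    have 2: "(\<Sum>j\<in>set is. of_bool (x $ j \<noteq> ?z $ j) :: real) = R"
      unfolding R_def by (rule sum.cong) (use i in \<open>auto simp: set_coord_nth\<close>)
    have 3: "n * (h * (hamming x ?z + a * n) + k) \<le> n * (h * (hamming x z + v BC + a * n) + k)"
      using hamming_set_coord_le[of x "spin (snd BC)" z i] n0 \<open>0 \<le> h\<close>
      by (intro mult_left_mono add_right_mono) (auto simp: v_def)
    have "?z \<in> hypercube" using Cons.prems(2) spin_in by (rule set_coord_hypercube)
    from Cons.IH[OF i(2) this, of ?y] show ?thesis
      unfolding 1 2 n_def[symmetric] using 3 by (simp add: algebra_simps)
  qed
  have v: "measure_pmf.expectation M v \<le> a"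
  proof -
    have "measure_pmf.expectation M v =
        b z i * of_bool (spin True \<noteq> z $ i) + (1 - b z i) * of_bool (spin False \<noteq> z $ i)"
      unfolding M_def v_def
      by (rule expectation_bernoulli_coupling_snd[OF \<alpha> b, where f="\<lambda>B. of_bool (spin B \<noteq> z $ i)"])
    also have "\<dots> \<le> a"
      using hypercube_nth[OF Cons.prems(2), of i]
    proof
      assume "z $ i = -1"
      then show ?thesis using move[OF Cons.prems(2), of i] by (simp add: spin_def)
    next
      assume "z $ i = 1"
      then show ?thesis using move[OF Cons.prems(2), of i] by (simp add: spin_def)
    qed
    finally show ?thesis .
  qed
  have u: "measure_pmf.expectation M u \<le> \<rho> * of_bool (x $ i \<noteq> z $ i) + h * hamming x z + k"
    using bernoulli_coupling_neq[OF \<alpha> b, of i z i] diff[OF Cons.prems(2), of i]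
    unfolding M_def u_def case_prod_beta by simp
  have "measure_pmf.expectation (sweep_coupling (\<lambda>_. \<alpha>) b (i # is) y z) (\<lambda>(y, z). hamming y z)
      \<le> measure_pmf.expectation M (\<lambda>BC. S + \<rho> * R + n * (h * (hamming x z + a * n) + k) + u BC + n * h * v BC)"
    unfolding sweep_coupling.simps M_def[symmetric]
    by (rule expectation_bind_le)
       (use step in \<open>auto simp: case_prod_beta finite_set_pmf_sweep_coupling\<close>)
  also have "\<dots> = S + \<rho> * R + n * (h * (hamming x z + a * n) + k)
      + measure_pmf.expectation M u + n * h * measure_pmf.expectation M v"
    by (simp add: fin)
  also have "\<dots> \<le> S + \<rho> * R + n * (h * (hamming x z + a * n) + k)
      + (\<rho> * of_bool (x $ i \<noteq> z $ i) + h * hamming x z + k) + n * h * a"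
    using u mult_left_mono[OF v, of "n * h"] n0 \<open>0 \<le> h\<close> by simp
  \<comment> \<open>The drift terms add up to \<open>h * a * (n * n + n)\<close>, which is
    \<open>h * a * (n + 1)\<close> below the claimed
    \<open>h * a * (n + 1) * (n + 1)\<close>.\<close>
  also have "\<dots> \<le> S + \<rho> * (of_bool (x $ i \<noteq> z $ i) + R) + (n + 1) * (h * (hamming x z + a * (n + 1)) + k)"
  proof -
    have "0 \<le> h * a * (n + 1)" using \<open>0 \<le> h\<close> \<open>0 \<le> a\<close> n0 by simp
    then show ?thesis by (simp add: algebra_simps)
  qed
  also have "of_bool (x $ i \<noteq> z $ i) + R = (\<Sum>j\<in>set (i # is). of_bool (x $ j \<noteq> z $ j))"
    unfolding R_def list.set(2) by (rule sum.insert[symmetric]) (use i in auto)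
  also have "n + 1 = real (length (i # is))" by (simp add: n_def)
  finally show ?case unfolding S_def .
qed

section \<open>The lazy heat bath preserves p, and a DULA step is a sweep\<close>

text \<open>The conditional probability under \<open>p\<close> that spin \<open>i\<close> is 1 given
  the other spins, in the logistic form suited to Lipschitz estimates; \<open>heat_bath_eq\<close>
  recovers the ratio of masses.\<close>

definition heat_bath :: "(real ^ 'n) pmf \<Rightarrow> real ^ 'n \<Rightarrow> 'n \<Rightarrow> real" where
  "heat_bath p z i = 1 / (1 + exp (- 2 * glauber_score p z $ i))"

text \<open>With probability \<open>1 - a\<close> the spin is kept, otherwise it is resampled by the
  heat bath.\<close>

definition lazy_gibbs :: "real \<Rightarrow> (real ^ 'n) pmf \<Rightarrow> real ^ 'n \<Rightarrow> 'n \<Rightarrow> real" where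
  "lazy_gibbs a p z i = (1 - a) * of_bool (z $ i = 1) + a * heat_bath p z i"

text \<open>Marginal probability of spin 1 under the product law with weights
  \<open>exp (c \<bullet> y)\<close>, where \<open>c\<close> is the exponent vector of the DULA
  kernel.\<close>

definition dula_up :: "real \<Rightarrow> (real ^ 'n \<Rightarrow> real ^ 'n) \<Rightarrow> real ^ 'n \<Rightarrow> 'n \<Rightarrow> real" where
  "dula_up \<eta> s x i = 1 / (1 + exp (- 2 * (x /\<^sub>R \<eta> + s x /\<^sub>R 2) $ i))"

lemma heat_bath_bounds: "0 < heat_bath p z i" "heat_bath p z i < 1"
  by (auto simp: heat_bath_def add_pos_pos)

lemma lazy_gibbs_bounds:
  assumes "0 \<le> a" "a \<le> 1"
  shows "lazy_gibbs a p z i \<in> {0..1}"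
proof -
  have "0 \<le> a * heat_bath p z i" "a * heat_bath p z i \<le> a"
    using assms heat_bath_bounds[of p z i] by (auto intro!: mult_left_le mult_nonneg_nonneg)
  then show ?thesis using assms by (auto simp: lazy_gibbs_def)
qed

text \<open>A flip requires that the spin be resampled.\<close>

lemma lazy_gibbs_move:
  assumes "0 \<le> a"
  shows "(if z $ i = 1 then 1 - lazy_gibbs a p z i else lazy_gibbs a p z i) \<le> a"
proof -
  have "0 \<le> a * heat_bath p z i" "a * heat_bath p z i \<le> a"
    using assms heat_bath_bounds[of p z i] by (auto intro!: mult_left_le mult_nonneg_nonneg)
  then show ?thesis by (auto simp: lazy_gibbs_def)
qed

lemma dula_up_bounds: "dula_up \<eta> s x i \<in> {0..1}"
  by (auto simp: dula_up_def add_pos_pos)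

lemma set_coord_set_coord: "set_coord v (set_coord u z i) i = set_coord v z i"
  by (simp add: set_coord_def vec_eq_iff)

lemma set_coord_eq_iff:
  "set_coord u z i = y \<longleftrightarrow> y $ i = u \<and> z = set_coord (z $ i) y i"
  by (auto simp: vec_eq_iff set_coord_nth)

lemma heat_bath_set_coord: "heat_bath p (set_coord u z i) i = heat_bath p z i"
  by (simp add: heat_bath_def glauber_score_def set_coord_set_coord)

lemma heat_bath_eq:
  assumes "set_pmf p = hypercube" "z \<in> hypercube"
  shows "heat_bath p z i =
    pmf p (set_coord 1 z i) / (pmf p (set_coord 1 z i) + pmf p (set_coord (-1) z i))"
proof -
  have "set_coord u z i \<in> set_pmf p" if "u \<in> {-1, 1}" for u
    using assms set_coord_hypercube that by blast
  then have pos: "0 < pmf p (set_coord 1 z i)" "0 < pmf p (set_coord (-1) z i)"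
    by (auto simp: pmf_positive_iff)
  have "- 2 * glauber_score p z $ i = ln (pmf p (set_coord (-1) z i)) - ln (pmf p (set_coord 1 z i))"
    by (simp add: glauber_score_def)
  then have e: "exp (- 2 * glauber_score p z $ i) = pmf p (set_coord (-1) z i) / pmf p (set_coord 1 z i)"
    using pos by (simp add: exp_diff)
  show ?thesis unfolding heat_bath_def e using pos by (simp add: field_simps)
qed

text \<open>An update moves mass only within a pair of states differing at \<open>i\<close>. Keeping
  the spin preserves both masses, and resampling redistributes the total mass of the pair in its
  original proportion.\<close>

lemma bind_lazy_gibbs_step:
  assumes p: "set_pmf p = hypercube" and a: "0 \<le> a" "a \<le> 1"
  shows "p \<bind> sweep (lazy_gibbs a p) [i] = p"
proof (rule pmf_eqI)
  fix y
  show "pmf (p \<bind> sweep (lazy_gibbs a p) [i]) y = pmf p y"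
  proof (cases "y \<in> hypercube")
    case False
    have "set_pmf (p \<bind> sweep (lazy_gibbs a p) [i]) \<subseteq> hypercube"
      unfolding set_bind_pmf p using set_pmf_sweep_hypercube by blast
    then have "y \<notin> set_pmf (p \<bind> sweep (lazy_gibbs a p) [i])" using False by blast
    moreover have "y \<notin> set_pmf p" using False p by simp
    ultimately show ?thesis by (simp only: set_pmf_iff not_not)
  next
    case True
    let ?u = "set_coord 1 y i" and ?d = "set_coord (-1) y i"
    let ?f = "\<lambda>z. lazy_gibbs a p z i * of_bool (set_coord 1 z i = y)
      + (1 - lazy_gibbs a p z i) * of_bool (set_coord (-1) z i = y)"
    have ud: "?u \<in> hypercube" "?d \<in> hypercube" using True by (auto intro: set_coord_hypercube)
    have ne: "?u \<noteq> ?d" by (auto simp: set_coord_def vec_eq_iff)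
    have "pmf (p \<bind> sweep (lazy_gibbs a p) [i]) y =
        (\<Sum>z\<in>hypercube. pmf p z * pmf (sweep (lazy_gibbs a p) [i] z) y)"
      unfolding pmf_bind
      by (subst integral_measure_pmf[where A=hypercube]) (auto simp: finite_hypercube p)
    also have "\<dots> = (\<Sum>z\<in>hypercube. pmf p z * ?f z)"
      by (intro sum.cong refl arg_cong2[where f="(*)"])
         (simp add: pmf_bind_bernoulli[OF lazy_gibbs_bounds[OF a]] spin_def indicator_def)
    \<comment> \<open>A state that can be sent to \<open>y\<close> agrees with \<open>y\<close> off
      \<open>i\<close>, which leaves two candidates.\<close>
    also have "\<dots> = (\<Sum>z\<in>{?u, ?d}. pmf p z * ?f z)"
    proof (rule sum.mono_neutral_right)
      show "\<forall>z\<in>hypercube - {?u, ?d}. pmf p z * ?f z = 0"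
      proof
        fix z assume "z \<in> hypercube - {?u, ?d}"
        then have "z \<noteq> set_coord (z $ i) y i" using hypercube_nth[of z i] by auto
        then have "set_coord v z i \<noteq> y" for v by (metis set_coord_eq_iff)
        then show "pmf p z * ?f z = 0" by simp
      qed
    qed (use ud finite_hypercube in auto)
    also have "\<dots> = pmf p ?u * ?f ?u + pmf p ?d * ?f ?d" using ne by simp
    also have "\<dots> = pmf p y"
    proof -
      define U where "U = pmf p ?u"
      define D where "D = pmf p ?d"
      have "?u \<in> set_pmf p" "?d \<in> set_pmf p" using ud p by auto
      then have pos: "0 < U" "0 < D" by (auto simp: pmf_positive_iff U_def D_def)
      have hb: "heat_bath p y i = U / (U + D)"
        unfolding U_def D_def using p True by (rule heat_bath_eq)
      have lu: "lazy_gibbs a p ?u i = (1 - a) + a * (U / (U + D))"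
        by (simp add: lazy_gibbs_def heat_bath_set_coord hb set_coord_nth)
      have ld: "lazy_gibbs a p ?d i = a * (U / (U + D))"
        by (simp add: lazy_gibbs_def heat_bath_set_coord hb set_coord_nth)
      have U: "U * ((1 - a) + a * (U / (U + D))) + D * (a * (U / (U + D))) = U"
      proof -
        have 1: "U * (U / (U + D)) + D * (U / (U + D)) = U"
          using pos by (simp flip: distrib_right add: add_divide_distrib[symmetric])
        have 2: "U * ((1 - a) + a * r) + D * (a * r) = (1 - a) * U + a * (U * r + D * r)" for r
          by (simp add: algebra_simps)
        show ?thesis unfolding 2 1 by (simp add: algebra_simps)
      qed
      have D': "D * (1 - s) + U * (1 - t) = U + D - (U * t + D * s)" for s t
        by (simp add: algebra_simps)
      \<comment> \<open>The total mass \<open>U + D\<close> of the pair is conserved, so the balance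
        for \<open>D\<close> follows from the one for \<open>U\<close>.\<close>
      have D: "D * (1 - a * (U / (U + D))) + U * (1 - ((1 - a) + a * (U / (U + D)))) = D"
        unfolding D' U by simp
      have f: "?f (set_coord v y i) = lazy_gibbs a p (set_coord v y i) i * of_bool (?u = y)
          + (1 - lazy_gibbs a p (set_coord v y i) i) * of_bool (?d = y)" for v
        by (simp only: set_coord_set_coord)
      have y: "set_coord (y $ i) y i = y" by (simp add: vec_eq_iff set_coord_nth)
      have "?u = y \<and> ?d \<noteq> y \<or> ?u \<noteq> y \<and> ?d = y"
        using hypercube_nth[OF True, of i] y ne by metis
      then show ?thesis
      proof (elim disjE conjE)
        assume *: "?u = y" "?d \<noteq> y"
        then have "pmf p y = U" by (simp add: U_def)
        then show ?thesis using * U unfolding f lu ld unfolding U_def[symmetric] D_def[symmetric]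
          by (simp add: set_coord_set_coord)
      next
        assume *: "?u \<noteq> y" "?d = y"
        then have "pmf p y = D" by (simp add: D_def)
        then show ?thesis using * D unfolding f lu ld unfolding U_def[symmetric] D_def[symmetric]
          by (simp add: set_coord_set_coord)
      qed
    qed
    finally show ?thesis .
  qed
qed

lemma bind_sweep_lazy_gibbs:
  assumes "set_pmf p = hypercube" "0 \<le> a" "a \<le> 1"
  shows "p \<bind> sweep (lazy_gibbs a p) is = p"
proof (induction "is")
  case Nil
  show ?case by (simp add: bind_return_pmf')
next
  case (Cons i "is")
  have "sweep (lazy_gibbs a p) (i # is) = (\<lambda>z. sweep (lazy_gibbs a p) [i] z \<bind> sweep (lazy_gibbs a p) is)"
    by (simp add: fun_eq_iff bind_assoc_pmf bind_return_pmf)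
  then show ?case
    by (simp only: bind_lazy_gibbs_step[OF assms] Cons flip: bind_assoc_pmf)
qed

text \<open>The exponent of the kernel is linear in \<open>y\<close>, so the kernel factorizes over
  the coordinates.\<close>

lemma pmf_sweep_dula_up:
  fixes x :: "real ^ 'n"
  assumes us: "distinct us" "set us = UNIV" and xy: "x \<in> hypercube" "y \<in> hypercube"
  shows "pmf (sweep (\<lambda>_. dula_up \<eta> s x) us x) y = dula_kernel \<eta> s x y"
proof -
  define c where "c = x /\<^sub>R \<eta> + s x /\<^sub>R 2"
  define K where "K = (\<Prod>j\<in>UNIV. exp (c $ j) + exp (- c $ j))"
  let ?M = "sweep (\<lambda>_. dula_up \<eta> s x) us x"
  have K: "K > 0" by (simp add: K_def prod_pos add_pos_pos)
  have M: "pmf ?M w = exp (c \<bullet> w) / K" if w: "w \<in> hypercube" for w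
  proof -
    have "(if w $ j = 1 then dula_up \<eta> s x j else 1 - dula_up \<eta> s x j)
        = exp (c $ j * w $ j) / (exp (c $ j) + exp (- c $ j))" for j
    proof -
      have up: "dula_up \<eta> s x j = exp (c $ j) / (exp (c $ j) + exp (- c $ j))"
      proof -
        have e: "exp (- 2 * c $ j) = exp (- c $ j) / exp (c $ j)"
          by (simp flip: exp_diff)
        show ?thesis unfolding dula_up_def c_def[symmetric] e
          by (simp add: field_simps)
      qed
      have "exp (c $ j) + exp (- c $ j) \<noteq> 0" using add_pos_pos[OF exp_gt_zero exp_gt_zero] by (metis less_irrefl)
      then show ?thesis
        using hypercube_nth[OF w, of j] by (auto simp: up divide_simps)
    qed
    then have "pmf ?M w = (\<Prod>j\<in>UNIV. exp (c $ j * w $ j) / (exp (c $ j) + exp (- c $ j)))"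
      using pmf_sweep_const[where \<alpha>="dula_up \<eta> s x", OF dula_up_bounds us(1) w, of x] us(2) by simp
    then show ?thesis by (simp add: prod_dividef K_def inner_vec_def exp_sum)
  qed
  \<comment> \<open>The sweep has total mass 1 on the cube; this identifies the partition function
    with \<open>K\<close> without expanding the product.\<close>
  have "(\<Sum>w\<in>hypercube. pmf ?M w) = 1"
    using set_pmf_sweep_hypercube[OF xy(1)] finite_hypercube by (intro sum_pmf_eq_1) auto
  then have "(\<Sum>w\<in>hypercube. exp (c \<bullet> w)) = K"
    using K by (simp add: M flip: sum_divide_distrib)
  then show ?thesis using M[OF xy(2)] by (simp add: dula_kernel_def c_def)
qed

lemma invariant_distribution_bind:
  assumes q: "invariant_distribution (dula_kernel \<eta> s) q"
    and us: "distinct us" "set us = UNIV"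
  shows "q \<bind> (\<lambda>x. sweep (\<lambda>_. dula_up \<eta> s x) us x) = q"
proof (rule pmf_eqI)
  fix y
  let ?f = "\<lambda>x. sweep (\<lambda>_. dula_up \<eta> s x) us x"
  have sq: "set_pmf q \<subseteq> hypercube" using q by (simp add: invariant_distribution_def)
  show "pmf (q \<bind> ?f) y = pmf q y"
  proof (cases "y \<in> hypercube")
    case False
    have "set_pmf (q \<bind> ?f) \<subseteq> hypercube"
      unfolding set_bind_pmf using sq set_pmf_sweep_hypercube by blast
    then have "y \<notin> set_pmf (q \<bind> ?f)" "y \<notin> set_pmf q" using False sq by blast+
    then show ?thesis by (simp only: set_pmf_iff not_not)
  next
    case True
    have "pmf (q \<bind> ?f) y = (\<Sum>x\<in>hypercube. pmf q x * pmf (?f x) y)"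
      unfolding pmf_bind using sq
      by (subst integral_measure_pmf[where A=hypercube]) (auto simp: finite_hypercube)
    also have "\<dots> = (\<Sum>x\<in>hypercube. pmf q x * dula_kernel \<eta> s x y)"
      using True us by (intro sum.cong) (simp_all add: pmf_sweep_dula_up)
    finally show ?thesis using q True by (simp add: invariant_distribution_def)
  qed
qed

section \<open>Comparison of the update probabilities\<close>

text \<open>The derivative is at most 1/4, by
  \<open>(1 - exp (- w))\<^sup>2 \<ge> 0\<close>.\<close>

lemma logistic_lipschitz:
  fixes u v :: real
  shows "\<bar>1 / (1 + exp (- u)) - 1 / (1 + exp (- v))\<bar> \<le> \<bar>u - v\<bar> / 4"
proof -
  let ?s = "\<lambda>u::real. 1 / (1 + exp (- u))"
  have pos: "1 + exp (- u) > 0" for u :: real by (simp add: add_pos_pos)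
  have "norm (?s u - ?s v) \<le> 1/4 * norm (u - v)"
  proof (rule field_differentiable_bound[where S=UNIV and f' = "\<lambda>u. exp (- u) / (1 + exp (- u))\<^sup>2"])
    fix w :: real
    show "(?s has_field_derivative exp (- w) / (1 + exp (- w))\<^sup>2) (at w within UNIV)"
      using pos[of w] by (auto intro!: derivative_eq_intros simp: power2_eq_square)
    have "4 * exp (- w) \<le> (1 + exp (- w))\<^sup>2"
      using zero_le_power2[of "1 - exp (- w)"] by (simp add: power2_eq_square algebra_simps)
    then show "norm (exp (- w) / (1 + exp (- w))\<^sup>2) \<le> 1/4"
      using pos[of w] by (simp add: field_simps)
  qed auto
  then show ?thesis by simp
qed

lemma l1norm_diff_hypercube:
  assumes "x \<in> hypercube" "y \<in> hypercube"
  shows "l1norm (x - y) = 2 * hamming x y"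
  unfolding l1norm_def hamming_def sum_distrib_left
proof (rule sum.cong[OF refl])
  fix i show "\<bar>(x - y) $ i\<bar> = 2 * of_bool (x $ i \<noteq> y $ i)"
    using hypercube_nth[OF assms(1), of i] hypercube_nth[OF assms(2), of i] by auto
qed

lemma glauber_score_diff_le:
  assumes "x \<in> hypercube" "y \<in> hypercube"
  shows "\<bar>glauber_score p x $ i - glauber_score p y $ i\<bar> \<le> beta2 p * (2 * hamming x y)"
\<comment> \<open>The maximum in \<open>beta2\<close> ranges over distinct points only; for equal
  ones both sides vanish.\<close>
proof (cases "x = y")
  case False
  let ?D = "\<lambda>(x, y). infnorm (glauber_score p x - glauber_score p y) / l1norm (x - y)"
  let ?A = "{infnorm (glauber_score p x - glauber_score p y) / l1norm (x - y) | x y.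
                    x \<in> hypercube \<and> y \<in> hypercube \<and> x \<noteq> y}"
  have "?A \<subseteq> ?D ` (hypercube \<times> hypercube)" by force
  then have "finite ?A" by (rule finite_subset) (simp add: finite_hypercube)
  moreover have "?D (x, y) \<in> ?A" using assms False by auto
  ultimately have le: "?D (x, y) \<le> beta2 p" unfolding beta2_def by (rule Max_ge)
  have "hamming x y > 0"
  proof -
    obtain j where "x $ j \<noteq> y $ j" using False by (auto simp: vec_eq_iff)
    then show ?thesis unfolding hamming_def by (intro sum_pos2[where i=j]) auto
  qed
  then have "infnorm (glauber_score p x - glauber_score p y) \<le> beta2 p * (2 * hamming x y)"
    using le by (simp add: l1norm_diff_hypercube assms divide_le_eq)
  moreover have "\<bar>(glauber_score p x - glauber_score p y) $ i\<bar> \<le> infnorm (glauber_score p x - glauber_score p y)"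
    by (rule component_le_infnorm_cart)
  ultimately show ?thesis by simp
qed (simp add: hamming_def)

text \<open>The factor 2 inside the logistic function, its Lipschitz constant 1/4 and the factor 2
  between l1 and Hamming distance multiply to 1.\<close>

lemma heat_bath_diff_le:
  assumes "x \<in> hypercube" "y \<in> hypercube"
  shows "\<bar>heat_bath p x i - heat_bath p y i\<bar> \<le> beta2 p * hamming x y"
proof -
  have "\<bar>heat_bath p x i - heat_bath p y i\<bar> \<le> \<bar>2 * glauber_score p x $ i - 2 * glauber_score p y $ i\<bar> / 4"
    unfolding heat_bath_def
    using logistic_lipschitz[of "2 * glauber_score p x $ i" "2 * glauber_score p y $ i"] by simp
  also have "\<dots> = \<bar>glauber_score p x $ i - glauber_score p y $ i\<bar> / 2"
    by (simp only: abs_mult flip: right_diff_distrib)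
  finally show ?thesis using glauber_score_diff_le[OF assms, of p i] by simp
qed

text \<open>With the Gibbs score, DULA flips a spin with probability \<open>g / (g + E)\<close>, where
  \<open>E = exp (2 / \<eta>)\<close> and \<open>g\<close> is the flip probability of the heat bath, instead of \<open>g / (1 + E)\<close>.\<close>
lemma dula_up_lazy_gibbs:
  assumes "\<eta> > 0" "x \<in> hypercube"
  defines "a \<equiv> 1 / (1 + exp (2 / \<eta>))"
  shows "\<bar>dula_up \<eta> (gibbs_score p) x i - lazy_gibbs a p x i\<bar> \<le> a\<^sup>2 / 2"
proof -
  define E where "E = exp (2 / \<eta>)"
  define r where "r = heat_bath p x i"
  define w where "w = glauber_score p x $ i"
  have E: "E \<ge> 1" using assms by (simp add: E_def)
  have r: "0 < r" "r < 1" using heat_bath_bounds by (auto simp: r_def)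
  \<comment> \<open>The difference is \<open>g * (1 - g) / ((g + E) * (1 + E))\<close>; now
    \<open>g * (1 - g) \<le> 1/4\<close>, and \<open>g + E \<ge> (1 + E) / 2\<close> because
    \<open>E \<ge> 1\<close>.\<close>
  have est: "\<bar>g / (g + E) - g / (1 + E)\<bar> \<le> a\<^sup>2 / 2" if g: "0 < g" "g < 1" for g
  proof -
    have "g / (g + E) - g / (1 + E) = g * (1 - g) / ((g + E) * (1 + E))"
      using g E by (simp add: divide_simps) (simp add: algebra_simps)
    then have "\<bar>g / (g + E) - g / (1 + E)\<bar> = g * (1 - g) / ((g + E) * (1 + E))"
      using g E by simp
    also have "\<dots> \<le> (1/4) / (((1 + E) / 2) * (1 + E))"
    proof (rule frac_le)
      have "0 \<le> (g - 1/2)\<^sup>2" by simp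
      then show "g * (1 - g) \<le> 1/4" by (simp add: power2_eq_square algebra_simps)
      show "(1 + E) / 2 * (1 + E) \<le> (g + E) * (1 + E)"
        using g E by (intro mult_right_mono) auto
    qed (use E in auto)
    also have "\<dots> = a\<^sup>2 / 2"
      using E by (simp add: a_def power2_eq_square flip: E_def)
    finally show ?thesis .
  qed
  have w: "exp (2 * w) > 0" "exp (- (2 * w)) = 1 / exp (2 * w)" by (auto simp: exp_minus field_simps)
  show ?thesis
  \<comment> \<open>The flip probability g is \<open>1 - r\<close> at spin 1 and \<open>r\<close> at
    spin -1. In both cases the Gibbs score has absolute value \<open>- ln g\<close>, so the odds of
    a DULA flip are \<open>g / E\<close>.\<close>
  proof (cases "x $ i = 1")
    case True
    have r': "1 - r = 1 / (1 + exp (2 * w))"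
    proof -
      have "r = 1 / (1 + 1 / exp (2 * w))"
        using w(2) by (simp add: r_def heat_bath_def flip: w_def)
      then show ?thesis using w(1) add_pos_pos[OF zero_less_one w(1)] by (simp add: field_simps)
    qed
    have "- 2 * (x /\<^sub>R \<eta> + gibbs_score p x /\<^sub>R 2) $ i = - (2 / \<eta>) - ln (1 + exp (2 * w))"
      using True by (simp add: gibbs_score_def w_def field_simps)
    then have e: "exp (- 2 * (x /\<^sub>R \<eta> + gibbs_score p x /\<^sub>R 2) $ i) = 1 / (E * (1 + exp (2 * w)))"
      using w(1) by (simp only: exp_diff exp_minus exp_ln[OF add_pos_pos[OF zero_less_one]])
         (simp add: E_def field_simps)
    have "1 / (1 + 1 / (E * A)) = 1 - (1 / A) / (1 / A + E)" if "A > 0" for A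
    proof -
      have "1 + E * A \<noteq> 0" "1 + A * E \<noteq> 0" using that E add_pos_pos[OF zero_less_one mult_pos_pos[of E A]]
        by (auto simp: mult.commute)
      then show ?thesis using that E by (simp add: field_simps)
    qed
    from this[OF add_pos_pos[OF zero_less_one w(1)]]
    have up: "dula_up \<eta> (gibbs_score p) x i = 1 - (1 - r) / ((1 - r) + E)"
      unfolding dula_up_def e r' .
    have "lazy_gibbs a p x i = 1 - a * (1 - r)"
      using True by (simp add: lazy_gibbs_def r_def algebra_simps)
    also have "a * (1 - r) = (1 - r) / (1 + E)" by (simp add: a_def E_def)
    finally have lz: "lazy_gibbs a p x i = 1 - (1 - r) / (1 + E)" .
    show ?thesis unfolding up lz using est[of "1 - r"] r by (simp add: abs_minus_commute)
  next
    case False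
    then have x: "x $ i = -1" using hypercube_nth[OF assms(2), of i] by auto
    have r': "r = 1 / (1 + exp (- (2 * w)))"
      by (simp add: r_def heat_bath_def flip: w_def)
    have "- 2 * (x /\<^sub>R \<eta> + gibbs_score p x /\<^sub>R 2) $ i = 2 / \<eta> + ln (1 + exp (- (2 * w)))"
      using x by (simp add: gibbs_score_def w_def field_simps)
    then have "exp (- 2 * (x /\<^sub>R \<eta> + gibbs_score p x /\<^sub>R 2) $ i) = E * (1 + exp (- (2 * w)))"
      by (simp only: exp_add exp_ln[OF add_pos_pos[OF zero_less_one exp_gt_zero]] E_def)
    also have "\<dots> = E / r" by (simp add: r')
    finally have e: "exp (- 2 * (x /\<^sub>R \<eta> + gibbs_score p x /\<^sub>R 2) $ i) = E / r" .
    have up: "dula_up \<eta> (gibbs_score p) x i = r / (r + E)"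
      unfolding dula_up_def e using r E by (simp add: divide_simps)
    have lz: "lazy_gibbs a p x i = r / (1 + E)"
      using x by (simp add: lazy_gibbs_def r_def a_def E_def)
    show ?thesis unfolding up lz using est[of r] r by simp
  qed
qed

text \<open>Triangle inequality through the lazy heat bath at \<open>x\<close>: the kept spins, the
  resampled spins and the DULA error give one term each.\<close>

lemma dula_up_lazy_gibbs_diff:
  assumes "\<eta> > 0" "x \<in> hypercube" "z \<in> hypercube"
  defines "a \<equiv> 1 / (1 + exp (2 / \<eta>))"
  shows "\<bar>dula_up \<eta> (gibbs_score p) x i - lazy_gibbs a p z i\<bar>
    \<le> (1 - a) * of_bool (x $ i \<noteq> z $ i) + a * beta2 p * hamming x z + a\<^sup>2 / 2"
proof -
  have a: "0 \<le> a" "a \<le> 1" by (auto simp: a_def add_pos_pos)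
  have "\<bar>lazy_gibbs a p x i - lazy_gibbs a p z i\<bar> \<le>
      \<bar>(1 - a) * (of_bool (x $ i = 1) - of_bool (z $ i = 1))\<bar> + \<bar>a * (heat_bath p x i - heat_bath p z i)\<bar>"
    by (rule order_trans[OF _ abs_triangle_ineq]) (simp add: lazy_gibbs_def algebra_simps)
  also have "\<bar>(1 - a) * (of_bool (x $ i = 1) - of_bool (z $ i = 1))\<bar> = (1 - a) * of_bool (x $ i \<noteq> z $ i)"
    using hypercube_nth[OF assms(2), of i] hypercube_nth[OF assms(3), of i] a by auto
  also have "\<bar>a * (heat_bath p x i - heat_bath p z i)\<bar> \<le> a * (beta2 p * hamming x z)"
    using a heat_bath_diff_le[OF assms(2,3), of p i] by (simp add: abs_mult mult_left_mono)
  finally show ?thesis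
    using dula_up_lazy_gibbs[OF assms(1,2), of p i, folded a_def] unfolding mult.assoc by linarith
qed

section \<open>Wasserstein distance and the contraction argument\<close>

lemma wasserstein_le_expectation:
  "\<pi> \<in> couplings q r \<Longrightarrow> wasserstein q r \<le> measure_pmf.expectation \<pi> (\<lambda>(x, y). hamming x y)"
  unfolding wasserstein_def
  by (rule cINF_lower) (auto intro!: bdd_belowI[of _ 0] integral_nonneg_AE simp: hamming_nonneg)

text \<open>The product coupling shows that the infimum is over a nonempty set.\<close>

lemma wasserstein_greatest:
  assumes "\<And>\<pi>. \<pi> \<in> couplings q r \<Longrightarrow> c \<le> measure_pmf.expectation \<pi> (\<lambda>(x, y). hamming x y)"
  shows "c \<le> wasserstein q r"
proof -
  have "pair_pmf q r \<in> couplings q r"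
    by (simp add: couplings_def map_fst_pair_pmf map_snd_pair_pmf)
  then show ?thesis unfolding wasserstein_def using assms by (intro cINF_greatest) auto
qed

theorem theorem4:
  fixes p q :: "(real ^ 'n) pmf" and \<eta> :: real
  assumes "set_pmf p = hypercube"
    and "\<eta> > 0"
    and "4 * real CARD('n) * beta2 p \<le> 1"
    and "real CARD('n) * exp (- 2 / \<eta>) \<le> 1"
    and "invariant_distribution (dula_kernel \<eta> (gibbs_score p)) q"
  shows "wasserstein q p \<le> 4 * real CARD('n) / (1 + exp (2 / \<eta>))"
proof -
  define d where "d = real CARD('n)"
  define a where "a = 1 / (1 + exp (2 / \<eta>))"
  define \<alpha> where "\<alpha> = dula_up \<eta> (gibbs_score p)"
  define b where "b = lazy_gibbs a p"
  obtain us :: "'n list" where us: "set us = UNIV" "distinct us"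
    using finite_distinct_list[of "UNIV :: 'n set"] by auto
  have d: "d > 0" by (simp add: d_def)
  have len: "real (length us) = d" using us distinct_card[of us] by (simp add: d_def)
  have a: "0 < a" "a \<le> 1" by (auto simp: a_def add_pos_pos)
  have \<alpha>: "\<alpha> x i \<in> {0..1}" for x i unfolding \<alpha>_def by (rule dula_up_bounds)
  have b: "b z i \<in> {0..1}" for z i unfolding b_def using a by (intro lazy_gibbs_bounds) auto
  have \<beta>: "beta2 p \<le> 1 / (4 * d)" using assms(3) d by (simp add: field_simps d_def)
  have q: "set_pmf q \<subseteq> hypercube" using assms(5) by (simp add: invariant_distribution_def)
  let ?C = "\<lambda>x z. sweep_coupling (\<lambda>_. \<alpha> x) b us x z"
  have contract: "measure_pmf.expectation (?C x z) (\<lambda>(y, z). hamming y z)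
      \<le> (1 - 3 * a / 4) * hamming x z + 3 / 4 * (d * a\<^sup>2)"
    if xz: "x \<in> hypercube" "z \<in> hypercube" for x z :: "real ^ 'n"
  proof -
    \<comment> \<open>Instance with \<open>\<rho> = 1 - a\<close>, \<open>h = a / (4 * d)\<close>
      and \<open>k = a\<^sup>2 / 2\<close>. Over all \<open>d\<close> coordinates the
      \<open>h\<close> term gives back \<open>a / 4\<close> of the distance plus a drift of
      \<open>d * a\<^sup>2 / 4\<close>, and the \<open>k\<close> term adds
      \<open>d * a\<^sup>2 / 2\<close>.\<close>
    have "measure_pmf.expectation (?C x z) (\<lambda>(y, z). hamming y z) \<le>
      (\<Sum>j\<in>-set us. of_bool (x $ j \<noteq> z $ j)) + (1 - a) * (\<Sum>j\<in>set us. of_bool (x $ j \<noteq> z $ j)) +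
      real (length us) * (a / (4 * d) * (hamming x z + a * real (length us)) + a\<^sup>2 / 2)"
    proof (rule expectation_hamming_sweep_coupling)
      fix z :: "real ^ 'n" and i assume z: "z \<in> hypercube"
      have "a * beta2 p * hamming x z \<le> a * (1 / (4 * d)) * hamming x z"
        using \<beta> a by (intro mult_right_mono mult_left_mono) (auto simp: hamming_nonneg)
      then show "\<bar>\<alpha> x i - b z i\<bar> \<le> (1 - a) * of_bool (x $ i \<noteq> z $ i) + a / (4 * d) * hamming x z + a\<^sup>2 / 2"
        using dula_up_lazy_gibbs_diff[OF assms(2) xz(1) z, of p i, folded a_def \<alpha>_def b_def] by simp
      show "(if z $ i = 1 then 1 - b z i else b z i) \<le> a"
        unfolding b_def using a by (intro lazy_gibbs_move) auto
    qed (use \<alpha> b a d us xz in auto)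
    also have "\<dots> = (1 - a) * hamming x z + d * (a / (4 * d) * (hamming x z + a * d) + a\<^sup>2 / 2)"
      unfolding len us(1) by (simp add: hamming_def)
    also have "\<dots> = (1 - 3 * a / 4) * hamming x z + 3 / 4 * (d * a\<^sup>2)"
      using d by (simp add: field_simps power2_eq_square)
    finally show ?thesis .
  qed
  have iter: "wasserstein q p \<le>
      (1 - 3 * a / 4) * measure_pmf.expectation \<pi> (\<lambda>(x, z). hamming x z) + 3 / 4 * (d * a\<^sup>2)"
    if \<pi>: "\<pi> \<in> couplings q p" for \<pi>
  proof -
    \<comment> \<open>Applying DULA to the first component and the lazy Gibbs sweep to the second
      preserves both marginals, so \<pi>' is again a coupling of \<open>q\<close> and
      \<open>p\<close>.\<close>
    define \<pi>' where "\<pi>' = \<pi> \<bind> (\<lambda>(x, z). ?C x z)"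
    have fst: "map_pmf fst \<pi> = q" and snd: "map_pmf snd \<pi> = p" using \<pi> by (auto simp: couplings_def)
    have supp: "set_pmf \<pi> \<subseteq> hypercube \<times> hypercube"
    proof
      fix xz assume "xz \<in> set_pmf \<pi>"
      then have "fst xz \<in> set_pmf (map_pmf fst \<pi>)" "snd xz \<in> set_pmf (map_pmf snd \<pi>)" by auto
      then show "xz \<in> hypercube \<times> hypercube"
        unfolding fst snd using q assms(1) by (auto simp: mem_Times_iff)
    qed
    then have fin: "finite (set_pmf \<pi>)" by (rule finite_subset) (simp add: finite_hypercube)
    have "map_pmf fst \<pi>' = \<pi> \<bind> (\<lambda>xz. sweep (\<lambda>_. \<alpha> (fst xz)) us (fst xz))"
      unfolding \<pi>'_def map_bind_pmf case_prod_beta sweep_coupling_marginals(1)[OF \<alpha> b] ..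
    also have "\<dots> = map_pmf fst \<pi> \<bind> (\<lambda>x. sweep (\<lambda>_. \<alpha> x) us x)" by (simp add: bind_map_pmf)
    also have "\<dots> = q"
      unfolding fst \<alpha>_def using assms(5) us by (intro invariant_distribution_bind)
    finally have 1: "map_pmf fst \<pi>' = q" .
    have "map_pmf snd \<pi>' = \<pi> \<bind> (\<lambda>xz. sweep b us (snd xz))"
      unfolding \<pi>'_def map_bind_pmf case_prod_beta sweep_coupling_marginals(2)[OF \<alpha> b] ..
    also have "\<dots> = map_pmf snd \<pi> \<bind> sweep b us" by (simp add: bind_map_pmf)
    also have "\<dots> = p"
      unfolding snd b_def using assms(1) a by (intro bind_sweep_lazy_gibbs) auto
    finally have "\<pi>' \<in> couplings q p" using 1 by (simp add: couplings_def)
    then have "wasserstein q p \<le> measure_pmf.expectation \<pi>' (\<lambda>(x, z). hamming x z)"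
      by (rule wasserstein_le_expectation)
    also have "\<dots> \<le> measure_pmf.expectation \<pi>
        (\<lambda>xz. (1 - 3 * a / 4) * (case xz of (x, z) \<Rightarrow> hamming x z) + 3 / 4 * (d * a\<^sup>2))"
      unfolding \<pi>'_def
      by (rule expectation_bind_le)
         (use fin supp contract in \<open>auto simp: finite_set_pmf_sweep_coupling\<close>)
    also have "\<dots> = (1 - 3 * a / 4) * measure_pmf.expectation \<pi> (\<lambda>(x, z). hamming x z) + 3 / 4 * (d * a\<^sup>2)"
      by (simp add: integrable_measure_pmf_finite[OF fin])
    finally show ?thesis .
  qed
  have pos: "1 - 3 * a / 4 > 0" using a by simp
  \<comment> \<open>\<open>iter\<close> holds for every coupling, so dividing by the positive
    contraction factor and passing to the infimum puts \<open>wasserstein q p\<close> on both sides;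
    an optimal coupling need not be exhibited.\<close>
  have "(wasserstein q p - 3 / 4 * (d * a\<^sup>2)) / (1 - 3 * a / 4) \<le> wasserstein q p"
  proof (rule wasserstein_greatest)
    fix \<pi> assume "\<pi> \<in> couplings q p"
    from iter[OF this] show "(wasserstein q p - 3 / 4 * (d * a\<^sup>2)) / (1 - 3 * a / 4)
        \<le> measure_pmf.expectation \<pi> (\<lambda>(x, y). hamming x y)"
      unfolding pos_divide_le_eq[OF pos] by (simp only: mult.commute)
  qed
  then have "a * wasserstein q p \<le> a * (d * a)"
    using pos by (simp add: divide_le_eq algebra_simps power2_eq_square)
  then have "wasserstein q p \<le> d * a" using a by simp
  also have "\<dots> \<le> 4 * d * a" using a d by simp
  finally show ?thesis by (simp add: d_def a_def)
qed

end
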